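(* Let $H$ and $K$ be strongly Archimedean, cancellative, duo monoids. Then every semigroup isomorphism $f\colon \mathfrak{I}(H)\to\mathfrak{I}(K)$ restricts to an isomorphism from $\mathfrak{P}(H)$ to $\mathfrak{P}(K)$ (that is, $f[\mathfrak{P}(H)]=\mathfrak{P}(K)$). In particular, if $\mathfrak{I}(H)$ is isomorphic to $\mathfrak{I}(K)$, then $H_{\mathrm{red}}$ is isomorphic to $K_{\mathrm{red}}$.
   Context: Monoids are written multiplicatively; $H^\times$ is the group of units of a monoid $H$. For subsets $X,Y$ of $H$, $XY:=\{xy : x\in X,\ y\in Y\}$, and braces of singletons are omitted in such products (e.g. $HaH = H\{a\}H$). A monoid $H$ is: cancellative if $ax\ne ay$ and $xa\neq ya$ for all $a,x,y\in H$ with $x\ne y$; duo if $aH=Ha$ for every $a\in H$; strongly Archimedean if, for every $a\in H$, there is an integer $k\ge 1$ such that $HaH$ contains every product $b_1\cdots b_k$ of $k$ non-units $b_1,\dots,b_k\in H$ (so every group is strongly Archimedean). An ideal of $H$ is a non-empty set $I\subseteq H$ with $IH\subseteq I$ and $HI\subseteq I$. The ideals of $H$ form a semigroup $\mathfrak{I}(H)$ under setwise multiplication. A principal ideal is a set of the form $HxH$ with $x\in H$, and $\mathfrak{P}(H)$ is the subsemigroup of $\mathfrak{I}(H)$ generated by the principal ideals. Two elements $a,b\in H$ are associated if $HaH=HbH$. The reduced quotient $H_{\mathrm{red}}$ is the quotient of $H$ by the smallest semigroup congruence containing the relation of associatedness. "Isomorphism" means semigroup isomorphism. *)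

theory Defs
  imports "HOL-Algebra.Divisibility"
begin

text \<open>Cancellativity is the library locale \<^locale>\<open>monoid_cancel\<close>, the set of units
  is \<^const>\<open>Units\<close>, setwise products are \<^const>\<open>set_mult\<close>. The relations
  \<^const>\<open>iso\<close> and \<^const>\<open>is_iso\<close> do not refer to the neutral elements, so that
  they express semigroup isomorphism.\<close>

definition duo :: "('a, 'm) monoid_scheme \<Rightarrow> bool"
  where "duo G \<longleftrightarrow> (\<forall>a\<in>carrier G. a <#\<^bsub>G\<^esub> carrier G = carrier G #>\<^bsub>G\<^esub> a)"

definition principal_ideal :: "('a, 'm) monoid_scheme \<Rightarrow> 'a \<Rightarrow> 'a set"
  where "principal_ideal G x = carrier G <#>\<^bsub>G\<^esub> {x} <#>\<^bsub>G\<^esub> carrier G"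

definition strongly_archimedean :: "('a, 'm) monoid_scheme \<Rightarrow> bool"
  where "strongly_archimedean G \<longleftrightarrow>
    (\<forall>a\<in>carrier G. \<exists>k\<ge>1. \<forall>bs. length bs = k \<and> set bs \<subseteq> carrier G - Units G \<longrightarrow>
       foldr (\<otimes>\<^bsub>G\<^esub>) bs \<one>\<^bsub>G\<^esub> \<in> principal_ideal G a)"

definition monoid_ideal :: "('a, 'm) monoid_scheme \<Rightarrow> 'a set \<Rightarrow> bool"
  where "monoid_ideal G I \<longleftrightarrow> I \<noteq> {} \<and> I \<subseteq> carrier G \<and>
    I <#>\<^bsub>G\<^esub> carrier G \<subseteq> I \<and> carrier G <#>\<^bsub>G\<^esub> I \<subseteq> I"

definition ideal_semigroup :: "('a, 'm) monoid_scheme \<Rightarrow> 'a set monoid"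
  where "ideal_semigroup G =
    \<lparr>carrier = {I. monoid_ideal G I}, mult = set_mult G, one = carrier G\<rparr>"

inductive_set principal_products :: "('a, 'm) monoid_scheme \<Rightarrow> 'a set set"
  for G :: "('a, 'm) monoid_scheme"
  where
    principal: "x \<in> carrier G \<Longrightarrow> principal_ideal G x \<in> principal_products G"
  | product: "I \<in> principal_products G \<Longrightarrow> J \<in> principal_products G \<Longrightarrow>
      I <#>\<^bsub>G\<^esub> J \<in> principal_products G"

definition principal_ideal_semigroup :: "('a, 'm) monoid_scheme \<Rightarrow> 'a set monoid"
  where "principal_ideal_semigroup G =
    \<lparr>carrier = principal_products G, mult = set_mult G, one = carrier G\<rparr>"

text \<open>The library's \<^const>\<open>associated\<close> is defined by one-sided divisibility; the relation
  used here compares two-sided principal ideals.\<close>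

definition ideal_associated :: "('a, 'm) monoid_scheme \<Rightarrow> ('a \<times> 'a) set"
  where "ideal_associated G =
    {(a, b) \<in> carrier G \<times> carrier G. principal_ideal G a = principal_ideal G b}"

definition semigroup_congruence :: "('a, 'm) monoid_scheme \<Rightarrow> ('a \<times> 'a) set \<Rightarrow> bool"
  where "semigroup_congruence G r \<longleftrightarrow> equiv (carrier G) r \<and>
    (\<forall>(a, b)\<in>r. \<forall>(c, d)\<in>r. (a \<otimes>\<^bsub>G\<^esub> c, b \<otimes>\<^bsub>G\<^esub> d) \<in> r)"

definition reduced_congruence :: "('a, 'm) monoid_scheme \<Rightarrow> ('a \<times> 'a) set"
  where "reduced_congruence G = \<Inter>{r. semigroup_congruence G r \<and> ideal_associated G \<subseteq> r}"

text \<open>The setwise product of two classes need not be a whole class, hence the image under the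
  congruence in the multiplication of the quotient.\<close>

definition reduced_quotient :: "('a, 'm) monoid_scheme \<Rightarrow> 'a set monoid"
  where "reduced_quotient G =
    \<lparr>carrier = carrier G // reduced_congruence G,
     mult = (\<lambda>X Y. reduced_congruence G `` (X <#>\<^bsub>G\<^esub> Y)),
     one = reduced_congruence G `` {\<one>\<^bsub>G\<^esub>}\<rparr>"

lemma (in monoid) semigroup_congruence_reduced:
  "semigroup_congruence G (reduced_congruence G)"
proof -
  have full: "semigroup_congruence G (carrier G \<times> carrier G)"
    by (auto simp: semigroup_congruence_def equiv_def refl_on_def sym_def trans_def)
  moreover have "ideal_associated G \<subseteq> carrier G \<times> carrier G"
    by (auto simp: ideal_associated_def)
  ultimately have sub: "reduced_congruence G \<subseteq> carrier G \<times> carrier G"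
    unfolding reduced_congruence_def by blast
  have "refl_on (carrier G) (reduced_congruence G)"
    by (auto simp: reduced_congruence_def semigroup_congruence_def equiv_def refl_on_def)
  moreover have "sym (reduced_congruence G)"
    unfolding reduced_congruence_def semigroup_congruence_def equiv_def sym_def by blast
  moreover have "trans (reduced_congruence G)"
  proof (rule transI)
    fix x y z assume "(x, y) \<in> reduced_congruence G" "(y, z) \<in> reduced_congruence G"
    then have "(x, z) \<in> r" if "semigroup_congruence G r" "ideal_associated G \<subseteq> r" for r
      using that transD[of r x y z]
      unfolding reduced_congruence_def semigroup_congruence_def equiv_def by simp
    then show "(x, z) \<in> reduced_congruence G"
      by (simp add: reduced_congruence_def)
  qed
  moreover have "(a \<otimes> c, b \<otimes> d) \<in> reduced_congruence G"
    if "(a, b) \<in> reduced_congruence G" "(c, d) \<in> reduced_congruence G" for a b c d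
    using that unfolding reduced_congruence_def semigroup_congruence_def by blast
  ultimately show ?thesis
    using sub by (auto simp: semigroup_congruence_def equiv_def)
qed

lemma (in monoid) reduced_quotient_mult:
  assumes "a \<in> carrier G" "b \<in> carrier G"
  shows "(reduced_congruence G `` {a}) \<otimes>\<^bsub>reduced_quotient G\<^esub> (reduced_congruence G `` {b})
    = reduced_congruence G `` {a \<otimes> b}"
proof -
  let ?r = "reduced_congruence G"
  have e: "equiv (carrier G) ?r"
    and m: "\<And>a b c d. (a, b) \<in> ?r \<Longrightarrow> (c, d) \<in> ?r \<Longrightarrow> (a \<otimes> c, b \<otimes> d) \<in> ?r"
    using semigroup_congruence_reduced by (auto simp: semigroup_congruence_def)
  have refl: "(a, a) \<in> ?r" "(b, b) \<in> ?r" and tr: "trans ?r"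
    using e assms by (auto simp: equiv_def refl_on_def)
  show ?thesis
  proof (intro equalityI subsetI)
    fix z assume "z \<in> ?r `` {a} \<otimes>\<^bsub>reduced_quotient G\<^esub> ?r `` {b}"
    then obtain x y where "(a, x) \<in> ?r" "(b, y) \<in> ?r" "(x \<otimes> y, z) \<in> ?r"
      by (auto simp: reduced_quotient_def set_mult_def)
    then show "z \<in> ?r `` {a \<otimes> b}"
      using transD[OF tr m] by blast
  next
    fix z assume "z \<in> ?r `` {a \<otimes> b}"
    then show "z \<in> ?r `` {a} \<otimes>\<^bsub>reduced_quotient G\<^esub> ?r `` {b}"
      using refl by (auto simp: reduced_quotient_def set_mult_def)
  qed
qed

end

theory Submission
  imports Defs
begin

text \<open>Principality of an ideal is visible in the ideal semigroup: the principal ideals are the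
  elements \<open>I\<close> with \<open>I X = I Y \<Longrightarrow> X = Y\<close>. Indeed, let \<open>I\<close> be non-principal. Strong
  Archimedeanity yields an \<open>a \<in> I\<close> whose divisors in \<open>I\<close> are all associated to \<open>a\<close>. Choose
  \<open>b \<in> I - aH\<close>, put \<open>u = ab\<close>, let \<open>Y\<close> be the ideal of all non-divisors of \<open>u\<close>, and let
  \<open>X = Y \<union> uH\<close>. For every \<open>c \<in> I\<close> one of \<open>a\<close>, \<open>b\<close>, say \<open>d\<close>, lies outside \<open>cH\<close>, while
  \<open>cu = dy\<close> for some \<open>y\<close>. If \<open>y\<close> divided \<open>u\<close>, cancellation would give \<open>d \<in> cH\<close>; hence
  \<open>y \<in> Y\<close>, and so \<open>I X = I Y\<close> although \<open>u \<in> X - Y\<close>.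

  In the duo case the principal ideals are already closed under products, associatedness is a
  congruence, and the reduced quotient is the semigroup of principal ideals.\<close>

section \<open>Semigroup isomorphisms and cancellative elements\<close>

lemma iso_inv_into:
  assumes h: "h \<in> iso G H"
    and closed: "\<And>x y. x \<in> carrier G \<Longrightarrow> y \<in> carrier G \<Longrightarrow> x \<otimes>\<^bsub>G\<^esub> y \<in> carrier G"
  shows "inv_into (carrier G) h \<in> iso H G"
proof -
  let ?g = "inv_into (carrier G) h"
  have bij: "bij_betw h (carrier G) (carrier H)"
    and hom: "\<And>x y. x \<in> carrier G \<Longrightarrow> y \<in> carrier G \<Longrightarrow> h (x \<otimes>\<^bsub>G\<^esub> y) = h x \<otimes>\<^bsub>H\<^esub> h y"
    using h by (auto simp: iso_def hom_def)
  have g: "?g x \<in> carrier G" "h (?g x) = x" if "x \<in> carrier H" for x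
    using bij that by (auto simp: bij_betw_def inv_into_into f_inv_into_f)
  have "?g (x \<otimes>\<^bsub>H\<^esub> y) = ?g x \<otimes>\<^bsub>G\<^esub> ?g y" if "x \<in> carrier H" "y \<in> carrier H" for x y
  proof -
    have "h (?g x \<otimes>\<^bsub>G\<^esub> ?g y) = x \<otimes>\<^bsub>H\<^esub> y"
      using that by (simp add: hom g)
    then show ?thesis
      using that bij by (metis bij_betw_def closed g(1) inv_into_f_f)
  qed
  then show ?thesis
    using bij_betw_inv_into[OF bij] g(1) by (auto simp: iso_def hom_def)
qed

text \<open>Formulated for a single element of an arbitrary structure, so that it can be evaluated
  at an ideal inside \<open>ideal_semigroup G\<close> and transported along isomorphisms.\<close>

definition left_cancellative :: "('a, 'm) monoid_scheme \<Rightarrow> 'a \<Rightarrow> bool"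
  where "left_cancellative G a \<longleftrightarrow>
    (\<forall>x\<in>carrier G. \<forall>y\<in>carrier G. a \<otimes>\<^bsub>G\<^esub> x = a \<otimes>\<^bsub>G\<^esub> y \<longrightarrow> x = y)"

lemma iso_left_cancellative:
  assumes f: "f \<in> iso G H" and a: "a \<in> carrier G"
    and closed: "\<And>x y. x \<in> carrier G \<Longrightarrow> y \<in> carrier G \<Longrightarrow> x \<otimes>\<^bsub>G\<^esub> y \<in> carrier G"
  shows "left_cancellative H (f a) \<longleftrightarrow> left_cancellative G a"
proof -
  have hom: "\<And>x y. x \<in> carrier G \<Longrightarrow> y \<in> carrier G \<Longrightarrow> f (x \<otimes>\<^bsub>G\<^esub> y) = f x \<otimes>\<^bsub>H\<^esub> f y"
    and inj: "inj_on f (carrier G)" and surj: "carrier H = f ` carrier G"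
    using f by (auto simp: iso_def hom_def bij_betw_def)
  have "f a \<otimes>\<^bsub>H\<^esub> f x = f a \<otimes>\<^bsub>H\<^esub> f y \<longleftrightarrow> a \<otimes>\<^bsub>G\<^esub> x = a \<otimes>\<^bsub>G\<^esub> y"
    if "x \<in> carrier G" "y \<in> carrier G" for x y
    using inj_on_eq_iff[OF inj closed closed] that a by (simp add: hom)
  moreover have "f x = f y \<longleftrightarrow> x = y" if "x \<in> carrier G" "y \<in> carrier G" for x y
    using inj_on_eq_iff[OF inj] that by simp
  ultimately show ?thesis
    unfolding left_cancellative_def surj by simp
qed

section \<open>Ideals of a monoid and their products\<close>

context monoid
begin

lemma set_mult_mem: "x \<in> A <#> B \<longleftrightarrow> (\<exists>a\<in>A. \<exists>b\<in>B. x = a \<otimes> b)"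
  by (auto simp: set_mult_def)

lemma monoid_idealD:
  assumes "monoid_ideal G I"
  shows "I \<noteq> {}" "I \<subseteq> carrier G" "x \<in> I \<Longrightarrow> x \<in> carrier G"
    "\<lbrakk>x \<in> I; h \<in> carrier G\<rbrakk> \<Longrightarrow> x \<otimes> h \<in> I" "\<lbrakk>x \<in> I; h \<in> carrier G\<rbrakk> \<Longrightarrow> h \<otimes> x \<in> I"
  using assms unfolding monoid_ideal_def set_mult_def by blast+

lemma monoid_idealI:
  assumes "I \<noteq> {}" "I \<subseteq> carrier G"
    "\<And>x h. \<lbrakk>x \<in> I; h \<in> carrier G\<rbrakk> \<Longrightarrow> x \<otimes> h \<in> I"
    "\<And>x h. \<lbrakk>x \<in> I; h \<in> carrier G\<rbrakk> \<Longrightarrow> h \<otimes> x \<in> I"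
  shows "monoid_ideal G I"
  using assms by (auto simp: monoid_ideal_def set_mult_def)

lemma monoid_ideal_set_mult:
  assumes I: "monoid_ideal G I" and J: "monoid_ideal G J"
  shows "monoid_ideal G (I <#> J)"
proof (rule monoid_idealI)
  show "I <#> J \<noteq> {}" "I <#> J \<subseteq> carrier G"
    using monoid_idealD(1,2)[OF I] monoid_idealD(1,2)[OF J] by (auto simp: set_mult_def)
next
  fix x h assume "x \<in> I <#> J" and h: "h \<in> carrier G"
  then obtain i j where x: "i \<in> I" "j \<in> J" "x = i \<otimes> j"
    by (auto simp: set_mult_def)
  then have "x \<otimes> h = i \<otimes> (j \<otimes> h)" "h \<otimes> x = (h \<otimes> i) \<otimes> j"
    using h monoid_idealD(3)[OF I] monoid_idealD(3)[OF J] by (simp_all add: m_assoc)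
  then show "x \<otimes> h \<in> I <#> J" "h \<otimes> x \<in> I <#> J"
    using x h monoid_idealD(5)[OF I] monoid_idealD(4)[OF J] unfolding set_mult_mem by blast+
qed

end

section \<open>Principal ideals in cancellative duo monoids\<close>

locale cancellative_duo_monoid = monoid_cancel +
  assumes duo: "duo G"
begin

lemma coset_swap: "a \<in> carrier G \<Longrightarrow> (\<exists>h\<in>carrier G. x = a \<otimes> h) \<longleftrightarrow> (\<exists>h\<in>carrier G. x = h \<otimes> a)"
  using duo unfolding duo_def l_coset_def r_coset_def by blast

text \<open>In a product h a k the duo property moves h to the right of a, so HaH = aH. With the
  mirrored version below, divisibility may be read from whichever side is convenient.\<close>

lemma mem_principal_ideal:
  assumes a: "a \<in> carrier G"
  shows "x \<in> principal_ideal G a \<longleftrightarrow> (\<exists>h\<in>carrier G. x = a \<otimes> h)"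
proof
  assume "x \<in> principal_ideal G a"
  then obtain h k where hk: "h \<in> carrier G" "k \<in> carrier G" "x = h \<otimes> a \<otimes> k"
    by (auto simp: principal_ideal_def set_mult_def)
  moreover obtain h' where "h' \<in> carrier G" "h \<otimes> a = a \<otimes> h'"
    using coset_swap[OF a] hk(1) by metis
  ultimately show "\<exists>h\<in>carrier G. x = a \<otimes> h"
    using a m_assoc m_closed by metis
next
  assume "\<exists>h\<in>carrier G. x = a \<otimes> h"
  then obtain h where "h \<in> carrier G" "x = \<one> \<otimes> a \<otimes> h"
    using a by auto
  then show "x \<in> principal_ideal G a"
    unfolding principal_ideal_def set_mult_def by blast
qed

lemma mem_principal_ideal':
  "a \<in> carrier G \<Longrightarrow> x \<in> principal_ideal G a \<longleftrightarrow> (\<exists>h\<in>carrier G. x = h \<otimes> a)"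
  by (simp add: mem_principal_ideal coset_swap)

lemma principal_ideal_self: "a \<in> carrier G \<Longrightarrow> a \<in> principal_ideal G a"
  by (metis mem_principal_ideal one_closed r_one)

lemma monoid_ideal_principal:
  assumes a: "a \<in> carrier G"
  shows "monoid_ideal G (principal_ideal G a)"
proof (rule monoid_idealI)
  show "principal_ideal G a \<noteq> {}"
    using principal_ideal_self[OF a] by blast
  show "principal_ideal G a \<subseteq> carrier G"
    using a by (auto simp: mem_principal_ideal)
next
  fix x h assume x: "x \<in> principal_ideal G a" and h: "h \<in> carrier G"
  show "x \<otimes> h \<in> principal_ideal G a"
    using x h a unfolding mem_principal_ideal[OF a] by (metis m_assoc m_closed)
  show "h \<otimes> x \<in> principal_ideal G a"
    using x h a unfolding mem_principal_ideal'[OF a] by (metis m_assoc m_closed)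
qed

lemma principal_ideal_subset:
  assumes "monoid_ideal G I" "a \<in> I"
  shows "principal_ideal G a \<subseteq> I"
  using monoid_idealD(3,4)[OF assms] by (auto simp: mem_principal_ideal)

lemma principal_ideal_trans:
  "\<lbrakk>a \<in> carrier G; b \<in> principal_ideal G a; c \<in> principal_ideal G b\<rbrakk> \<Longrightarrow> c \<in> principal_ideal G a"
  using principal_ideal_subset monoid_ideal_principal by blast

lemma unit_of_one_in_principal_ideal:
  assumes "a \<in> carrier G" "\<one> \<in> principal_ideal G a"
  shows "a \<in> Units G"
proof -
  obtain h where h: "h \<in> carrier G" "a \<otimes> h = \<one>"
    using assms mem_principal_ideal by metis
  moreover obtain k where k: "k \<in> carrier G" "k \<otimes> a = \<one>"
    using assms mem_principal_ideal' by metis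
  ultimately have "k = h"
    using assms(1) inv_unique by blast
  then show ?thesis
    using assms(1) h k unfolding Units_def by blast
qed

text \<open>Writing the first factor as h a and the second as b k keeps a and b adjacent, so the
  product is a two-sided multiple of ab.\<close>

lemma principal_ideal_mult:
  assumes a: "a \<in> carrier G" and b: "b \<in> carrier G"
  shows "principal_ideal G a <#> principal_ideal G b = principal_ideal G (a \<otimes> b)"
proof (intro equalityI subsetI)
  fix x assume "x \<in> principal_ideal G a <#> principal_ideal G b"
  then obtain h k where hk: "h \<in> carrier G" "k \<in> carrier G" "x = (h \<otimes> a) \<otimes> (b \<otimes> k)"
    using a b by (auto simp: set_mult_def mem_principal_ideal[OF b] mem_principal_ideal'[OF a])
  then have "x = h \<otimes> (a \<otimes> b \<otimes> k)"
    using a b by (simp add: m_assoc)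
  then show "x \<in> principal_ideal G (a \<otimes> b)"
    using monoid_idealD(4,5)[OF monoid_ideal_principal] principal_ideal_self hk(1,2) a b by simp
next
  fix x assume "x \<in> principal_ideal G (a \<otimes> b)"
  then obtain h where h: "h \<in> carrier G" "x = a \<otimes> b \<otimes> h"
    using a b mem_principal_ideal by auto
  then have "x = a \<otimes> (b \<otimes> h)"
    using a b by (simp add: m_assoc)
  moreover have "b \<otimes> h \<in> principal_ideal G b"
    using h(1) b mem_principal_ideal by blast
  ultimately show "x \<in> principal_ideal G a <#> principal_ideal G b"
    using principal_ideal_self[OF a] unfolding set_mult_mem by blast
qed

lemma principal_products_eq: "principal_products G = principal_ideal G ` carrier G"
proof (intro equalityI subsetI)
  fix I assume "I \<in> principal_products G"
  then show "I \<in> principal_ideal G ` carrier G"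
    by induction (auto simp: principal_ideal_mult)
qed (auto intro: principal_products.principal)

text \<open>Since X absorbs factors from H, (aH)X is just the translate aX. Translation by a is
  injective on elements, hence on subsets.\<close>

lemma left_cancellative_principal_ideal:
  assumes a: "a \<in> carrier G"
  shows "left_cancellative (ideal_semigroup G) (principal_ideal G a)"
proof -
  have mult: "principal_ideal G a <#> X = (\<lambda>x. a \<otimes> x) ` X" if X: "monoid_ideal G X" for X
  proof (intro equalityI subsetI)
    fix z assume "z \<in> principal_ideal G a <#> X"
    then obtain h x where "h \<in> carrier G" "x \<in> X" "z = a \<otimes> h \<otimes> x"
      by (auto simp: set_mult_def mem_principal_ideal[OF a])
    then show "z \<in> (\<lambda>x. a \<otimes> x) ` X"
      using a monoid_idealD(3,5)[OF X] by (auto simp: m_assoc)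
  next
    fix z assume "z \<in> (\<lambda>x. a \<otimes> x) ` X"
    then show "z \<in> principal_ideal G a <#> X"
      using principal_ideal_self[OF a] by (auto simp: set_mult_def)
  qed
  have "inj_on (\<lambda>x. a \<otimes> x) (carrier G)"
    using a l_cancel by (auto simp: inj_on_def)
  then have "(\<lambda>x. a \<otimes> x) ` X = (\<lambda>x. a \<otimes> x) ` Y \<longleftrightarrow> X = Y"
    if "X \<subseteq> carrier G" "Y \<subseteq> carrier G" for X Y
    using that inj_on_image_eq_iff by blast
  then show ?thesis
    by (simp add: left_cancellative_def ideal_semigroup_def mult monoid_idealD(2))
qed

section \<open>Principal ideals as the cancellative elements of the ideal semigroup\<close>

text \<open>A unit in I divides everything. If I has no units, its elements cannot all be products
  of arbitrarily many non-units; choose n such that all of them are products of n non-units but some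
  a is not a product of n + 1. If a = hc with c in I, then h must be a unit.\<close>

lemma strongly_archimedean_minimal:
  assumes arch: "strongly_archimedean G" and I: "monoid_ideal G I"
  shows "\<exists>a\<in>I. \<forall>c\<in>I. a \<in> principal_ideal G c \<longrightarrow> c \<in> principal_ideal G a"
proof (cases "I \<inter> Units G = {}")
  case False
  then obtain a where a: "a \<in> I" "a \<in> Units G"
    by blast
  have "c \<in> principal_ideal G a" if "c \<in> I" for c
  proof -
    have c: "c \<in> carrier G"
      using that monoid_idealD(3)[OF I] by blast
    then have "c = a \<otimes> (inv a \<otimes> c)"
      using a(2) m_assoc[of a "inv a" c, symmetric] by (simp add: Units_closed)
    then show ?thesis
      using a(2) c by (metis Units_closed Units_inv_closed m_closed mem_principal_ideal)
  qed
  then show ?thesis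
    using a(1) by blast
next
  case True
  \<comment> \<open>\<open>M n\<close> consists of the products of exactly n non-units; the empty
    product gives \<open>\<one>\<close> in \<open>M 0\<close>.\<close>
  define M where "M n = (\<lambda>bs. foldr (\<otimes>) bs \<one>) ` {bs. length bs = n \<and> set bs \<subseteq> carrier G - Units G}" for n
  have M_Suc: "m \<otimes> c \<in> M (Suc n)" if "m \<in> carrier G - Units G" "c \<in> M n" for m c n
    using that(2)
  proof (unfold M_def, elim imageE)
    fix bs assume "c = foldr (\<otimes>) bs \<one>" "bs \<in> {bs. length bs = n \<and> set bs \<subseteq> carrier G - Units G}"
    then show "m \<otimes> c \<in> (\<lambda>bs. foldr (\<otimes>) bs \<one>) ` {bs. length bs = Suc n \<and> set bs \<subseteq> carrier G - Units G}"
      using that(1) by (intro image_eqI[of _ _ "m # bs"]) auto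
  qed
  have one_M: "\<one> \<in> M 0"
    unfolding M_def by (rule image_eqI[of _ _ "[]"]) simp_all
  obtain e where e: "e \<in> I"
    using monoid_idealD(1)[OF I] by blast
  then have ec: "e \<in> carrier G"
    using monoid_idealD(3)[OF I] by blast
  \<comment> \<open>The Archimedean property is applied to the square of e: membership of e in
    \<open>M k\<close> would then make e a multiple of its own square, and cancelling e would make
    it a unit.\<close>
  have "e \<otimes> e \<in> carrier G"
    using ec by simp
  then obtain k where k: "k \<ge> 1" "M k \<subseteq> principal_ideal G (e \<otimes> e)"
    using arch unfolding strongly_archimedean_def M_def image_subset_iff mem_Collect_eq by blast
  have "e \<notin> M k"
  proof
    assume "e \<in> M k"
    then obtain h where h: "h \<in> carrier G" "e = e \<otimes> e \<otimes> h"
      using k(2) ec mem_principal_ideal[of "e \<otimes> e" e] by auto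
    then have "e \<otimes> \<one> = e \<otimes> (e \<otimes> h)"
      using ec by (simp add: m_assoc)
    then have "\<one> = e \<otimes> h"
      using ec h(1) l_cancel[of e \<one> "e \<otimes> h"] by simp
    then have "e \<in> Units G"
      using ec h(1) unit_of_one_in_principal_ideal mem_principal_ideal by blast
    then show False
      using True e by blast
  qed
  \<comment> \<open>As k is at least 1, it has the form \<open>Suc n\<close>.\<close>
  then have ex: "\<exists>n. \<not> I \<subseteq> M (Suc n)"
    using k(1) e by (metis One_nat_def Suc_le_D subsetD)
  \<comment> \<open>The first failure at \<open>Suc n\<close> is not at n = 0, because every element
    of I is a single non-unit. Minimality at the predecessor of n therefore gives I inside
    \<open>M n\<close>.\<close>
  define n where "n = (LEAST n. \<not> I \<subseteq> M (Suc n))"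
  have n: "\<not> I \<subseteq> M (Suc n)"
    unfolding n_def using ex by (rule LeastI_ex)
  have "I \<subseteq> M (Suc 0)"
    using M_Suc[OF _ one_M] True monoid_idealD(3)[OF I] by force
  then have "n \<noteq> 0"
    using n by metis
  then obtain m where m: "n = Suc m"
    using not0_implies_Suc by blast
  have sub: "I \<subseteq> M n"
    using not_less_Least[of m "\<lambda>n. \<not> I \<subseteq> M (Suc n)"] m unfolding n_def[symmetric] by simp
  obtain a where a: "a \<in> I" "a \<notin> M (Suc n)"
    using n by blast
  have "c \<in> principal_ideal G a" if c: "c \<in> I" "a \<in> principal_ideal G c" for c
  proof -
    have cc: "c \<in> carrier G"
      using c(1) monoid_idealD(3)[OF I] by blast
    obtain h where h: "h \<in> carrier G" "a = h \<otimes> c"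
      using c(2) mem_principal_ideal'[OF cc] by blast
    \<comment> \<open>A non-unit h would put a = hc into \<open>M (Suc n)\<close>, since c lies in
      \<open>M n\<close>.\<close>
    then have u: "h \<in> Units G"
      using M_Suc[of h c n] a(2) sub c(1) by blast
    then have "c = inv h \<otimes> a"
      using h cc m_assoc[of "inv h" h c, symmetric] by simp
    then show ?thesis
      using u mem_principal_ideal' h cc Units_inv_closed m_closed by metis
  qed
  then show ?thesis
    using a(1) by blast
qed

lemma principal_of_left_cancellative:
  assumes arch: "strongly_archimedean G" and I: "monoid_ideal G I"
    and canc: "left_cancellative (ideal_semigroup G) I"
  shows "\<exists>a\<in>carrier G. I = principal_ideal G a"
proof (rule ccontr)
  assume nonprincipal: "\<not> ?thesis"
  obtain a where a: "a \<in> I" and minimal: "\<And>c. c \<in> I \<Longrightarrow> a \<in> principal_ideal G c \<Longrightarrow> c \<in> principal_ideal G a"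
    using strongly_archimedean_minimal[OF arch I] by blast
  have ac: "a \<in> carrier G"
    using monoid_idealD(3)[OF I] a by blast
  \<comment> \<open>I contains aH, so without such a b it would equal aH.\<close>
  obtain b where b: "b \<in> I" "b \<notin> principal_ideal G a"
    using nonprincipal principal_ideal_subset[OF I a] ac by blast
  have bc: "b \<in> carrier G"
    using monoid_idealD(3)[OF I] b by blast
  \<comment> \<open>Both a and b divide u: a from the left, and b from the right.\<close>
  define u where "u = a \<otimes> b"
  have uc: "u \<in> carrier G"
    using ac bc by (simp add: u_def)
  define Y where "Y = {y \<in> carrier G. u \<notin> principal_ideal G y}"
  define X where "X = Y \<union> principal_ideal G u"
  have key: "\<exists>d\<in>I. \<exists>y\<in>Y. c \<otimes> u = d \<otimes> y" if c: "c \<in> I" for c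
  proof -
    have cc: "c \<in> carrier G"
      using monoid_idealD(3)[OF I] c by blast
    \<comment> \<open>If a were in cH, minimality would put c in aH; then b in cH would force b in
      aH.\<close>
    obtain d where d: "d \<in> {a, b}" "d \<notin> principal_ideal G c"
      using minimal[OF c] principal_ideal_trans[OF ac] b(2) by blast
    have dI: "d \<in> I" and dc: "d \<in> carrier G"
      using d(1) a b ac bc by auto
    have "u \<in> principal_ideal G d"
      using d(1) ac bc mem_principal_ideal[OF ac] mem_principal_ideal'[OF bc] by (auto simp: u_def)
    then have "c \<otimes> u \<in> principal_ideal G d"
      using monoid_idealD(5)[OF monoid_ideal_principal[OF dc]] cc by blast
    then obtain y where y: "y \<in> carrier G" "c \<otimes> u = d \<otimes> y"
      using mem_principal_ideal[OF dc] by blast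
    have "u \<notin> principal_ideal G y"
    proof
      assume "u \<in> principal_ideal G y"
      then obtain h where h: "h \<in> carrier G" "u = h \<otimes> y"
        using mem_principal_ideal'[OF y(1)] by blast
      then have "c \<otimes> h \<otimes> y = d \<otimes> y"
        using y cc by (simp add: m_assoc)
      then have "d = c \<otimes> h"
        using r_cancel y(1) cc dc h(1) by (metis m_closed)
      then show False
        using d(2) mem_principal_ideal[OF cc] h(1) by blast
    qed
    then show ?thesis
      using y dI by (auto simp: Y_def)
  qed
  have Y: "monoid_ideal G Y"
  proof (rule monoid_idealI)
    \<comment> \<open>The exchange \<open>key\<close>, applied to c = a, already produces an element
      of \<open>Y\<close>.\<close>
    show "Y \<noteq> {}" "Y \<subseteq> carrier G"
      using key[OF a] by (auto simp: Y_def)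
  next
    fix x h assume x: "x \<in> Y" and h: "h \<in> carrier G"
    then have xc: "x \<in> carrier G"
      by (simp add: Y_def)
    have "x \<otimes> h \<in> principal_ideal G x" "h \<otimes> x \<in> principal_ideal G x"
      using h mem_principal_ideal[OF xc] mem_principal_ideal'[OF xc] by blast+
    then show "x \<otimes> h \<in> Y" "h \<otimes> x \<in> Y"
      using x xc h principal_ideal_trans[OF xc] by (auto simp: Y_def)
  qed
  have uI: "monoid_ideal G (principal_ideal G u)"
    using uc by (rule monoid_ideal_principal)
  have X: "monoid_ideal G X"
    using Y uI unfolding X_def by (intro monoid_idealI) (auto dest: monoid_idealD)
  have "z \<in> I <#> Y" if "z \<in> I <#> X" for z
  proof -
    obtain c x where z: "c \<in> I" "x \<in> X" "z = c \<otimes> x"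
      using \<open>z \<in> I <#> X\<close> by (auto simp: set_mult_def)
    show ?thesis
    proof (cases "x \<in> Y")
      case True
      then show ?thesis
        using z by (auto simp: set_mult_def)
    next
      case False
      then obtain h where h: "h \<in> carrier G" "x = u \<otimes> h"
        using z(2) mem_principal_ideal[OF uc] by (auto simp: X_def)
      \<comment> \<open>The exchange for u extends to its multiples: c(uh) = (dy)h = d(yh), and yh
        stays in the ideal \<open>Y\<close>.\<close>
      obtain d y where dy: "d \<in> I" "y \<in> Y" "c \<otimes> u = d \<otimes> y"
        using key[OF z(1)] by blast
      then have "z = d \<otimes> (y \<otimes> h)"
        using z h uc monoid_idealD(3)[OF I] monoid_idealD(3)[OF Y] by (metis m_assoc)
      then show ?thesis
        using dy h(1) monoid_idealD(4)[OF Y] by (auto simp: set_mult_def)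
    qed
  qed
  moreover have "I <#> Y \<subseteq> I <#> X"
    by (auto simp: X_def set_mult_def)
  ultimately have "I <#> X = I <#> Y"
    by blast
  then have "X = Y"
    using canc X Y by (simp add: left_cancellative_def ideal_semigroup_def)
  moreover have "u \<in> X" "u \<notin> Y"
    using principal_ideal_self[OF uc] by (auto simp: X_def Y_def)
  ultimately show False
    by blast
qed

text \<open>The right-hand side is expressed through the semigroup structure of
  \<open>ideal_semigroup G\<close> alone, so every isomorphism preserves it.\<close>

lemma principal_products_iff_left_cancellative:
  assumes "strongly_archimedean G"
  shows "principal_products G = {I \<in> carrier (ideal_semigroup G). left_cancellative (ideal_semigroup G) I}"
proof (intro equalityI subsetI)
  fix I assume "I \<in> principal_products G"
  then show "I \<in> {I \<in> carrier (ideal_semigroup G). left_cancellative (ideal_semigroup G) I}"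
    by (auto simp: principal_products_eq left_cancellative_principal_ideal)
      (simp add: ideal_semigroup_def monoid_ideal_principal)
next
  fix I assume "I \<in> {I \<in> carrier (ideal_semigroup G). left_cancellative (ideal_semigroup G) I}"
  then have "monoid_ideal G I" "left_cancellative (ideal_semigroup G) I"
    by (auto simp: ideal_semigroup_def)
  then show "I \<in> principal_products G"
    using principal_of_left_cancellative[OF assms] unfolding principal_products_eq by blast
qed

section \<open>The reduced quotient as the semigroup of principal ideals\<close>

text \<open>Associatedness is already a congruence, because the principal ideal of a product is
  determined by the principal ideals of the factors.\<close>

lemma reduced_congruence_eq: "reduced_congruence G = ideal_associated G"
proof
  have "equiv (carrier G) (ideal_associated G)"
    by (auto simp: ideal_associated_def equiv_def refl_on_def sym_def trans_def)
  moreover have "(a \<otimes> c, b \<otimes> d) \<in> ideal_associated G"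
    if "(a, b) \<in> ideal_associated G" "(c, d) \<in> ideal_associated G" for a b c d
    using that by (auto simp: ideal_associated_def simp flip: principal_ideal_mult)
  ultimately show "reduced_congruence G \<subseteq> ideal_associated G"
    unfolding reduced_congruence_def semigroup_congruence_def by blast
qed (auto simp: reduced_congruence_def)

text \<open>The map sends a principal ideal to the set of its generators, which is a full class of
  associated elements.\<close>

lemma iso_principal_ideal_semigroup_reduced_quotient:
  "(\<lambda>I. {b \<in> carrier G. principal_ideal G b = I}) \<in> iso (principal_ideal_semigroup G) (reduced_quotient G)"
proof -
  let ?\<phi> = "\<lambda>I. {b \<in> carrier G. principal_ideal G b = I}"
  have fibre: "?\<phi> (principal_ideal G a) = reduced_congruence G `` {a}" if "a \<in> carrier G" for a
    using that by (auto simp: reduced_congruence_eq ideal_associated_def)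
  have "inj_on ?\<phi> (principal_products G)"
  proof (rule inj_onI)
    fix I J assume IJ: "I \<in> principal_products G" "J \<in> principal_products G" and eq: "?\<phi> I = ?\<phi> J"
    \<comment> \<open>Every member of \<open>principal_products G\<close> has a generator, so its
      fibre is non-empty and determines it.\<close>
    from IJ(1) obtain a where "a \<in> ?\<phi> I"
      by (auto simp: principal_products_eq)
    moreover from this have "a \<in> ?\<phi> J"
      unfolding eq .
    ultimately show "I = J"
      by simp
  qed
  moreover have "?\<phi> ` principal_products G = carrier G // reduced_congruence G"
    unfolding principal_products_eq image_image quotient_def UNION_singleton_eq_range
    by (rule image_cong[OF refl fibre])
  ultimately have bij: "bij_betw ?\<phi> (principal_products G) (carrier G // reduced_congruence G)"
    by (simp add: bij_betw_def)
  have "?\<phi> (I <#> J) = ?\<phi> I \<otimes>\<^bsub>reduced_quotient G\<^esub> ?\<phi> J"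
    if "I \<in> principal_products G" "J \<in> principal_products G" for I J
  proof -
    from that obtain a b where "a \<in> carrier G" "b \<in> carrier G"
      "I = principal_ideal G a" "J = principal_ideal G b"
      by (auto simp: principal_products_eq)
    then show ?thesis
      by (simp add: fibre principal_ideal_mult reduced_quotient_mult)
  qed
  then show ?thesis
    using bij bij_betw_imp_funcset[OF bij]
    by (simp add: iso_def hom_def principal_ideal_semigroup_def reduced_quotient_def)
qed

end

theorem theorem18:
  fixes H :: "('a, 'm) monoid_scheme" and K :: "('b, 'n) monoid_scheme"
  assumes "monoid_cancel H" and "duo H" and "strongly_archimedean H"
    and "monoid_cancel K" and "duo K" and "strongly_archimedean K"
  shows "(\<forall>f \<in> iso (ideal_semigroup H) (ideal_semigroup K).
            f \<in> iso (principal_ideal_semigroup H) (principal_ideal_semigroup K) \<and>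
            f ` carrier (principal_ideal_semigroup H) = carrier (principal_ideal_semigroup K))
       \<and> (ideal_semigroup H \<cong> ideal_semigroup K \<longrightarrow>
            reduced_quotient H \<cong> reduced_quotient K)"
proof -
  interpret H: cancellative_duo_monoid H
    using assms by (simp add: cancellative_duo_monoid_def cancellative_duo_monoid_axioms_def)
  interpret K: cancellative_duo_monoid K
    using assms by (simp add: cancellative_duo_monoid_def cancellative_duo_monoid_axioms_def)
  let ?I = "ideal_semigroup H" and ?J = "ideal_semigroup K"
  let ?P = "principal_ideal_semigroup H" and ?Q = "principal_ideal_semigroup K"
  \<comment> \<open>Both carriers are rewritten in semigroup terms, which reduces the restriction
    claim to invariance of \<open>left_cancellative\<close> under f.\<close>
  have P: "carrier ?P = {I \<in> carrier ?I. left_cancellative ?I I}"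
    and Q: "carrier ?Q = {I \<in> carrier ?J. left_cancellative ?J I}"
    using H.principal_products_iff_left_cancellative K.principal_products_iff_left_cancellative assms
    by (simp_all add: principal_ideal_semigroup_def)
  have mult: "mult ?P = mult ?I" "mult ?Q = mult ?J"
    by (simp_all add: principal_ideal_semigroup_def ideal_semigroup_def)
  have restrict: "f \<in> iso ?P ?Q" "f ` carrier ?P = carrier ?Q" if f: "f \<in> iso ?I ?J" for f
  proof -
    have closed: "x \<otimes>\<^bsub>?I\<^esub> y \<in> carrier ?I" if "x \<in> carrier ?I" "y \<in> carrier ?I" for x y
      using that H.monoid_ideal_set_mult by (simp add: ideal_semigroup_def)
    have hom: "f (x \<otimes>\<^bsub>?I\<^esub> y) = f x \<otimes>\<^bsub>?J\<^esub> f y" if "x \<in> carrier ?I" "y \<in> carrier ?I" for x y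
      using f that by (auto simp: iso_iff hom_def)
    have surj: "f ` carrier ?I = carrier ?J" and inj: "inj_on f (carrier ?I)"
      using f by (auto simp: iso_iff)
    have canc: "left_cancellative ?J (f I) \<longleftrightarrow> left_cancellative ?I I" if "I \<in> carrier ?I" for I
      using iso_left_cancellative[OF f that closed] .
    show image: "f ` carrier ?P = carrier ?Q"
      unfolding P Q surj[symmetric] using canc by auto
    have "inj_on f (carrier ?P)"
      using inj unfolding P by (rule inj_on_subset) blast
    moreover have "f (x \<otimes>\<^bsub>?P\<^esub> y) = f x \<otimes>\<^bsub>?Q\<^esub> f y" if "x \<in> carrier ?P" "y \<in> carrier ?P" for x y
      using that hom unfolding mult P by simp
    ultimately show "f \<in> iso ?P ?Q"
      using image by (auto simp: iso_iff hom_def)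
  qed
  have "reduced_quotient H \<cong> reduced_quotient K" if "?I \<cong> ?J"
  proof -
    from that obtain f where f: "f \<in> iso ?I ?J"
      by (auto simp: is_iso_def)
    \<comment> \<open>Closure is what \<open>iso_inv_into\<close> requires to reverse the map from
      \<open>?P\<close> to the reduced quotient, giving the first link of the chain.\<close>
    have "x \<otimes>\<^bsub>?P\<^esub> y \<in> carrier ?P" if "x \<in> carrier ?P" "y \<in> carrier ?P" for x y
      using that by (simp add: principal_ideal_semigroup_def principal_products.product)
    then have "reduced_quotient H \<cong> ?P"
      by (rule is_isoI[OF iso_inv_into[OF H.iso_principal_ideal_semigroup_reduced_quotient]])
    also have "?P \<cong> ?Q"
      by (rule is_isoI[OF restrict(1)[OF f]])
    also have "?Q \<cong> reduced_quotient K"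
      by (rule is_isoI[OF K.iso_principal_ideal_semigroup_reduced_quotient])
    finally show ?thesis .
  qed
  with restrict show ?thesis
    by simp
qed

end
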